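(* Consider an imprecise Markov chain with state space $\mathcal{X}$, any extended real variable $f\colon\Omega\to\mathbb{R}\cup\{-\infty,+\infty\}$, any situation $s$ and any $x\in\mathcal{X}$. Then $$\underline{E}(f|sx)=\underline{E}(f(s\,\bullet)|x),$$ where $sx$ is the situation obtained by appending $x$ to $s$, and $f(s\,\bullet)$ is the extended real variable $\omega\mapsto f(s\omega)$, with $s\omega$ the path obtained by concatenating $s$ and $\omega$.
   Context: Write $\mathbb{N}=\{1,2,\dots\}$, $\mathbb{N}_0=\mathbb{N}\cup\{0\}$. Let $\mathcal{X}$ be a non-empty finite set (state space). A situation is a finite string $x_{1:n}=(x_1,\dots,x_n)\in\mathcal{X}^n$, $n\in\mathbb{N}_0$; the empty string is $\square$. A path is an element $\omega=(\omega_1,\omega_2,\dots)$ of $\Omega:=\mathcal{X}^{\mathbb{N}}$; $\omega^n:=(\omega_1,\dots,\omega_n)$. For a situation $s=x_{1:n}$, $\Gamma(s):=\{\omega\in\Omega:\omega^n=x_{1:n}\}$. A gamble on a set $Y$ is a bounded function $Y\to\mathbb{R}$; $\mathcal{G}(Y)$ is the set of these. A lower expectation on $\mathcal{G}(Y)$ is a functional $\underline{E}\colon\mathcal{G}(Y)\to\mathbb{R}$ with $\underline{E}(f)\geq\inf f$, $\underline{E}(f+g)\geq\underline{E}(f)+\underline{E}(g)$ and $\underline{E}(\lambda f)=\lambda\underline{E}(f)$ for all gambles $f,g$ and real $\lambda\geq0$. An imprecise Markov chain attaches to each situation $x_{1:n}$ a lower expectation $\underline{Q}(\cdot|x_{1:n})$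 on $\mathcal{G}(\mathcal{X})$ such that $\underline{Q}(\cdot|x_{1:n})=\underline{Q}(\cdot|x_n)$ for all $n\in\mathbb{N}$ and $x_{1:n}\in\mathcal{X}^n$. A real process is a real-valued map $\mathcal{F}$ on situations; $\Delta\mathcal{F}(x_{1:n})(x_{n+1}):=\mathcal{F}(x_{1:n+1})-\mathcal{F}(x_{1:n})$. A submartingale is a real process $\mathcal{M}$ with $\underline{Q}(\Delta\mathcal{M}(t)|t)\geq0$ for all situations $t$. For an extended real variable $f$ and a situation $t$, the global conditional lower expectation is $$\underline{E}(f|t):=\sup\{\mathcal{M}(t):\mathcal{M}\text{ a bounded above submartingale with }\limsup_{n\to\infty}\mathcal{M}(\omega^n)\leq f(\omega)\text{ for all }\omega\in\Gamma(t)\},$$ with $\sup\emptyset=-\infty$. *)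

theory Defs
  imports "HOL-Library.Extended_Real" "HOL-Library.Stream"
begin

(* The state space is a type 'a :: finite; types are non-empty.  Situations are lists (the
   empty situation is []), paths are streams; the initial segment of length n of a path w is
   stake n w, and the concatenation of a situation s with w is s @- w. *)

type_synonym 'a situation = "'a list"
type_synonym 'a path = "'a stream"

definition cylinder :: "'a situation \<Rightarrow> 'a path set" where
  "cylinder t = {\<omega>. stake (length t) \<omega> = t}"

definition gamble :: "('y \<Rightarrow> real) \<Rightarrow> bool" where
  "gamble f \<longleftrightarrow> bdd_above (range f) \<and> bdd_below (range f)"

(* Only the values of E on gambles matter; on a finite type every function is a gamble. *)
definition lower_expectation :: "(('y \<Rightarrow> real) \<Rightarrow> real) \<Rightarrow> bool" where
  "lower_expectation E \<longleftrightarrow>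
     (\<forall>f. gamble f \<longrightarrow> (INF y. f y) \<le> E f) \<and>
     (\<forall>f g. gamble f \<longrightarrow> gamble g \<longrightarrow> E f + E g \<le> E (\<lambda>y. f y + g y)) \<and>
     (\<forall>f c. gamble f \<longrightarrow> 0 \<le> c \<longrightarrow> E (\<lambda>y. c * f y) = c * E f)"

(* Q t g is the local lower expectation of the gamble g conditional on the situation t. *)
definition imprecise_markov_chain ::
  "('a::finite situation \<Rightarrow> ('a \<Rightarrow> real) \<Rightarrow> real) \<Rightarrow> bool" where
  "imprecise_markov_chain Q \<longleftrightarrow>
     (\<forall>t. lower_expectation (Q t)) \<and> (\<forall>t. t \<noteq> [] \<longrightarrow> Q t = Q [last t])"

definition process_difference :: "('a situation \<Rightarrow> real) \<Rightarrow> 'a situation \<Rightarrow> 'a \<Rightarrow> real" where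
  "process_difference F t x = F (t @ [x]) - F t"

definition submartingale ::
  "('a::finite situation \<Rightarrow> ('a \<Rightarrow> real) \<Rightarrow> real) \<Rightarrow> ('a situation \<Rightarrow> real) \<Rightarrow> bool" where
  "submartingale Q M \<longleftrightarrow> (\<forall>t. 0 \<le> Q t (process_difference M t))"

(* Sup is taken in the complete lattice ereal, so that Sup {} = - \<infinity>. *)
definition global_lower_expectation ::
  "('a::finite situation \<Rightarrow> ('a \<Rightarrow> real) \<Rightarrow> real) \<Rightarrow> ('a path \<Rightarrow> ereal) \<Rightarrow> 'a situation \<Rightarrow> ereal"
where
  "global_lower_expectation Q f t =
     Sup {ereal (M t) | M. submartingale Q M \<and> bdd_above (range M) \<and>
            (\<forall>\<omega>\<in>cylinder t. limsup (\<lambda>n. ereal (M (stake n \<omega>))) \<le> f \<omega>)}"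

end

theory Submission
  imports Defs "HOL-Analysis.Extended_Real_Limits"
begin

text \<open>
  The value at a non-empty situation depends only on its last state and on how the variable looks
  on the paths that continue it. Indeed, a submartingale \<open>M\<close> seen from \<open>t\<close> can be transplanted to
  any situation \<open>t'\<close> that ends in the same state: copy \<open>M\<close> from the subtree below \<open>t\<close> to the subtree
  below \<open>t'\<close>, and use the constant \<open>M t\<close> everywhere else. By the Markov property, the local models
  at \<open>t @ v\<close> and \<open>t' @ v\<close> coincide, so the increments below \<open>t'\<close> keep non-negative lower expectation;
  all other increments vanish. Boundedness, the value at the root of the subtree, and the limits
  superior along the paths are preserved. This gives the inequality
  \<open>global_lower_expectation_transplant\<close>, and the theorem is this inequality in both directions, for
  the situations \<open>s @ [x]\<close> and \<open>[x]\<close>.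
\<close>

lemma lower_expectation_zero_nonneg:
  fixes E :: "('y \<Rightarrow> real) \<Rightarrow> real"
  assumes "lower_expectation E"
  shows "0 \<le> E (\<lambda>_. 0)"
proof -
  have "gamble (\<lambda>_ :: 'y. 0)" by (simp add: gamble_def)
  then have "(INF y :: 'y. 0) \<le> E (\<lambda>_. 0)"
    using assms unfolding lower_expectation_def by blast
  then show ?thesis by simp
qed

lemma imprecise_markov_chain_append_cong:
  assumes "imprecise_markov_chain Q" "t \<noteq> []" "t' \<noteq> []" "last t = last t'"
  shows "Q (t @ v) = Q (t' @ v)"
proof -
  have "Q u = Q [last u]" if "u \<noteq> []" for u
    using assms(1) that unfolding imprecise_markov_chain_def by blast
  from this[of "t @ v"] this[of "t' @ v"] show ?thesis
    using assms(2-4) by (cases "v = []") simp_all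
qed

text \<open>
  The process that follows \<open>M\<close> below \<open>t\<close> on the situations that extend \<open>t'\<close>, and that is constantly
  \<open>M t\<close> on all other situations, the strict predecessors of \<open>t'\<close> included.
\<close>

definition transplant ::
  "'a situation \<Rightarrow> 'a situation \<Rightarrow> ('a situation \<Rightarrow> real) \<Rightarrow> 'a situation \<Rightarrow> real" where
  "transplant t t' M u =
     (if take (length t') u = t' then M (t @ drop (length t') u) else M t)"

lemma transplant_append [simp]: "transplant t t' M (t' @ v) = M (t @ v)"
  by (simp add: transplant_def)

lemma transplant_root [simp]: "transplant t t' M t' = M t"
  by (simp add: transplant_def)

lemma range_transplant_subset: "range (transplant t t' M) \<subseteq> range M"
  by (auto simp: transplant_def)

lemma submartingale_transplant:
  assumes chain: "imprecise_markov_chain Q"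
    and "t \<noteq> []" "t' \<noteq> []" "last t = last t'"
    and M: "submartingale Q M"
  shows "submartingale Q (transplant t t' M)"
  unfolding submartingale_def
proof
  fix u
  show "0 \<le> Q u (process_difference (transplant t t' M) u)"
  proof (cases "take (length t') u = t'")
    case True
    then obtain v where u: "u = t' @ v"
      by (metis append_take_drop_id)
    have "process_difference (transplant t t' M) u = process_difference M (t @ v)"
      by (auto simp: u process_difference_def)
    moreover have "Q u = Q (t @ v)"
      using imprecise_markov_chain_append_cong[OF assms(1-4)] by (simp add: u)
    ultimately show ?thesis
      using M by (simp add: submartingale_def)
  next
    case False
    have "process_difference (transplant t t' M) u y = 0" for y
    proof (cases "take (length t') (u @ [y]) = t'")
      case True
      \<comment> \<open>A one-step extension can enter the subtree only at its root, where the value is \<open>M t\<close>.\<close>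
      with False have "u @ [y] = t'"
        by (cases "length t' \<le> length u") simp_all
      with False show ?thesis
        by (auto simp: process_difference_def transplant_def)
    next
      case False
      with \<open>take (length t') u \<noteq> t'\<close> show ?thesis
        by (simp add: process_difference_def transplant_def)
    qed
    then have "process_difference (transplant t t' M) u = (\<lambda>_. 0)" ..
    with chain show ?thesis
      by (simp add: imprecise_markov_chain_def lower_expectation_zero_nonneg)
  qed
qed

lemma limsup_along_shift:
  fixes F :: "'a situation \<Rightarrow> ereal"
  shows "limsup (\<lambda>n. F (stake n (t @- w))) = limsup (\<lambda>n. F (t @ stake n w))"
proof -
  have "limsup (\<lambda>n. F (stake n (t @- w))) = limsup (\<lambda>n. F (stake (n + length t) (t @- w)))"
    by (rule limsup_shift_k[symmetric])
  also have "\<dots> = limsup (\<lambda>n. F (t @ stake n w))"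
    by (simp add: stake_shift)
  finally show ?thesis .
qed

lemma cylinder_eq_range_shift: "cylinder t = range (shift t)"
proof
  show "cylinder t \<subseteq> range (shift t)"
  proof
    fix w assume "w \<in> cylinder t"
    then have "w = t @- sdrop (length t) w"
      by (metis (mono_tags) cylinder_def mem_Collect_eq stake_sdrop)
    then show "w \<in> range (shift t)" by (rule range_eqI)
  qed
qed (auto simp: cylinder_def stake_shift)

lemma global_lower_expectation_transplant:
  assumes "imprecise_markov_chain Q" "t \<noteq> []" "t' \<noteq> []" "last t = last t'"
    and le: "\<And>w. g (t @- w) \<le> h (t' @- w)"
  shows "global_lower_expectation Q g t \<le> global_lower_expectation Q h t'"
  unfolding global_lower_expectation_def[of Q g]
proof (rule Sup_least, clarify)
  fix M
  assume M: "submartingale Q M" "bdd_above (range M)"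
    and lim: "\<forall>\<omega>\<in>cylinder t. limsup (\<lambda>n. ereal (M (stake n \<omega>))) \<le> g \<omega>"
  let ?N = "transplant t t' M"
  have "limsup (\<lambda>n. ereal (?N (stake n (t' @- w)))) \<le> h (t' @- w)" for w
  proof -
    have "limsup (\<lambda>n. ereal (?N (stake n (t' @- w)))) = limsup (\<lambda>n. ereal (M (stake n (t @- w))))"
      using limsup_along_shift[of "\<lambda>u. ereal (?N u)" t' w]
        limsup_along_shift[of "\<lambda>u. ereal (M u)" t w] by simp
    also have "\<dots> \<le> g (t @- w)"
      using lim by (simp add: cylinder_eq_range_shift)
    also note le
    finally show ?thesis .
  qed
  then have "\<forall>\<omega>\<in>cylinder t'. limsup (\<lambda>n. ereal (?N (stake n \<omega>))) \<le> h \<omega>"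
    by (simp add: cylinder_eq_range_shift)
  moreover have "submartingale Q ?N"
    using submartingale_transplant[OF assms(1-4) M(1)] .
  moreover have "bdd_above (range ?N)"
    using M(2) range_transplant_subset by (rule bdd_above_mono)
  moreover have "ereal (M t) = ereal (?N t')"
    by simp
  ultimately show "ereal (M t) \<le> global_lower_expectation Q h t'"
    unfolding global_lower_expectation_def by (intro Sup_upper) blast
qed

theorem proposition19:
  fixes Q :: "'a::finite situation \<Rightarrow> ('a \<Rightarrow> real) \<Rightarrow> real"
    and f :: "'a path \<Rightarrow> ereal"
    and s :: "'a situation"
    and x :: 'a
  assumes "imprecise_markov_chain Q"
  shows "global_lower_expectation Q f (s @ [x])
       = global_lower_expectation Q (\<lambda>\<omega>. f (s @- \<omega>)) [x]"
  using assms by (intro antisym global_lower_expectation_transplant) simp_all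

end
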